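(* When $\sum_n r_n<+\infty$, all the processes $(\mathbf{Z}_n)_n$, $(\mathbf{Z}_n^{(1)})_n$, $(\mathbf{Z}_n^{(2)})_n$ and $(\mathbf{Z}_n^{(3)})_n$ converge almost surely. Moreover, denoting by $Z_{\infty,l}$ the almost sure limit of $(Z_{n,l})_n$, for any pair of vertices $(l_1,l_2)\in V\times V$ with $l_1\ne l_2$ we have $P(Z_{\infty,l_1}\ne Z_{\infty,l_2})>0$.
   Context: Let $N\ge 2$, $V=\{1,\dots,N\}$, and let $W=[w_{l_1,l_2}]_{l_1,l_2\in V}$ be an irreducible real matrix with non-negative entries such that $W^\top\mathbf{1}=\mathbf{1}$, where $\mathbf{1}$ is the all-ones vector ($\mathbf{0}$ is the zero vector). Let $(r_n)_{n\ge0}$ be a deterministic sequence with $0<r_n<1$. Let $\mathbf{Z}_0=[Z_{0,1},\dots,Z_{0,N}]^\top$ be a random vector with values in $[0,1]^N$ such that $P(\mathbf{Z}_0=\mathbf{0})+P(\mathbf{Z}_0=\mathbf{1})<1$ and, for $n\ge 0$, let $\mathcal{F}_n=\sigma(Z_{0,l}:l\in V)\vee\sigma(X_{k,l}:1\le k\le n,\,l\in V)$. Given $\mathcal{F}_n$, the random variables $X_{n+1,l}$, $l\in V$, are $\{0,1\}$-valued and conditionally independent with $P(X_{n+1,l}=1\mid\mathcal{F}_n)=\sum_{l_1=1}^N w_{l_1,l}Z_{n,l_1}=[W^\top\mathbf{Z}_n]_l$, and $\mathbf{Z}_{n+1}=(1-r_n)\mathbf{Z}_n+r_n\mathbf{X}_{n+1}$,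 where $\mathbf{X}_{n}=[X_{n,1},\dots,X_{n,N}]^\top$, $\mathbf{Z}_{n}=[Z_{n,1},\dots,Z_{n,N}]^\top$. Let $n_{\mathrm{per}}\ge1$ be the period of the irreducible matrix $W^\top$ ($\gcd\{k\ge1:[(W^\top)^k]_{l,l}>0\}$, independent of $l$). The set $V$ is partitioned into $n_{\mathrm{per}}$ cyclic classes, numbered $0,\dots,n_{\mathrm{per}}-1$ (numbers modulo $n_{\mathrm{per}}$), such that $[W^\top]_{l_1,l_2}=0$ when $l_1$ is in class $h$ and $l_2$ is not in class $h+1$; they are the communicating classes of $(W^\top)^{n_{\mathrm{per}}}$. Write $l_1\sim_c l_2$ if $l_1,l_2$ are in the same cyclic class. Let $\mathbf{v}$ be the unique vector with strictly positive entries with $\mathbf{v}^\top W^\top=\mathbf{v}^\top$ and $\mathbf{v}^\top\mathbf{1}=1$. Decomposition $\mathbf{Z}_n=\mathbf{Z}_n^{(1)}+\mathbf{Z}_n^{(2)}+\mathbf{Z}_n^{(3)}$: set $\widetilde Z_n=\mathbf{v}^\top\mathbf{Z}_n$, $\mathbf{Z}_n^{(1)}=\widetilde Z_n\mathbf{1}$; set $Z_{n,l}^{(C)}=\sum_{l_1\sim_c l}\frac{v_{l_1}}{\sum_{l_2\sim_c l}v_{l_2}}Z_{n,l_1}$ for $l\in V$ and $\mathbf{Z}_n^{(2)}=\mathbf{Z}_n^{(C)}-\widetilde Z_n\mathbf{1}$; finally $\mathbf{Z}_n^{(3)}=\mathbf{Z}_n-\mathbf{Z}_n^{(1)}-\mathbf{Z}_n^{(2)}$.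 *)

theory Defs
  imports "HOL-Probability.Probability"
begin

section \<open>Nonnegative matrices: irreducibility, period, cyclic classes\<close>

text \<open>Powers with respect to the matrix product; the class operation \<open>^\<close> on vectors is componentwise.\<close>

primrec mat_power :: "real^'n^'n \<Rightarrow> nat \<Rightarrow> real^'n^'n" where
  "mat_power A 0 = mat 1"
| "mat_power A (Suc k) = A ** mat_power A k"

text \<open>Irreducibility is meant for matrices with nonnegative entries, where positivity of
  an entry of a power expresses the existence of a path of that length.\<close>

definition irreducible_mat :: "real^'n^'n \<Rightarrow> bool" where
  "irreducible_mat A \<longleftrightarrow> (\<forall>i j. \<exists>k\<ge>1. 0 < mat_power A k $ i $ j)"

text \<open>The period of the state \<open>l\<close>; it does not depend on \<open>l\<close> when \<open>A\<close> is nonnegative and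
  irreducible (lemma \<open>period_indep\<close> below).\<close>

definition period :: "real^'n^'n \<Rightarrow> 'n \<Rightarrow> nat" where
  "period A l = Gcd {k. 1 \<le> k \<and> 0 < mat_power A k $ l $ l}"

definition communicate :: "real^'n^'n \<Rightarrow> 'n \<Rightarrow> 'n \<Rightarrow> bool" where
  "communicate A i j \<longleftrightarrow>
     (\<exists>k. 0 < mat_power A k $ i $ j) \<and> (\<exists>k. 0 < mat_power A k $ j $ i)"

text \<open>Being in the same cyclic class: the cyclic classes are the communicating classes of
  the power of \<open>A\<close> whose exponent is the period. Lemmas \<open>same_cyclic_class_iff\<close> and
  \<open>cyclic_numbering_exists\<close> below show that this agrees with the partition given by the
  cyclic numbering of the states.\<close>

definition same_cyclic_class :: "real^'n^'n \<Rightarrow> 'n \<Rightarrow> 'n \<Rightarrow> bool" where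
  "same_cyclic_class A i j \<longleftrightarrow> communicate (mat_power A (period A i)) i j"

definition cyclic_numbering :: "real^'n^'n \<Rightarrow> ('n \<Rightarrow> nat) \<Rightarrow> bool" where
  "cyclic_numbering A c \<longleftrightarrow>
     (\<forall>i. c i < period A i) \<and>
     (\<forall>i j. c j \<noteq> (c i + 1) mod period A i \<longrightarrow> A $ i $ j = 0)"

lemma mat_power_add: "mat_power A (m + n) = mat_power A m ** mat_power A n"
  by (induction m) (simp_all add: matrix_mul_assoc)

lemma mat_power_mult: "mat_power A (m * n) = mat_power (mat_power A m) n"
  by (induction n) (simp_all add: mat_power_add)

lemma mat_power_nonneg:
  assumes "\<And>i j. 0 \<le> A $ i $ j"
  shows "0 \<le> mat_power A k $ i $ j"
  by (induction k arbitrary: i j)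
    (auto simp: mat_def matrix_matrix_mult_def assms intro!: sum_nonneg)

lemma mat_power_add_pos:
  assumes "\<And>i j. 0 \<le> A $ i $ j"
    and "0 < mat_power A m $ i $ j" and "0 < mat_power A n $ j $ l"
  shows "0 < mat_power A (m + n) $ i $ l"
proof -
  have "0 < mat_power A m $ i $ j * mat_power A n $ j $ l"
    using assms by simp
  also have "\<dots> \<le> (\<Sum>h\<in>UNIV. mat_power A m $ i $ h * mat_power A n $ h $ l)"
    by (rule member_le_sum) (auto intro!: mult_nonneg_nonneg mat_power_nonneg assms(1))
  finally show ?thesis
    by (simp add: mat_power_add matrix_matrix_mult_def)
qed

lemma period_dvd: "0 < mat_power A k $ l $ l \<Longrightarrow> period A l dvd k"
  unfolding period_def by (cases "k = 0") (auto intro!: Gcd_dvd)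

lemma period_indep:
  assumes "\<And>i j. 0 \<le> A $ i $ j" and "irreducible_mat A"
  shows "period A i = period A j"
proof -
  have "period A i dvd period A j" for i j
    unfolding period_def[of A j]
  proof (rule Gcd_greatest)
    fix k assume "k \<in> {k. 1 \<le> k \<and> 0 < mat_power A k $ j $ j}"
    then have k: "0 < mat_power A k $ j $ j" by simp
    obtain m n where m: "0 < mat_power A m $ i $ j" and n: "0 < mat_power A n $ j $ i"
      using assms(2) unfolding irreducible_mat_def by blast
    have "period A i dvd m + n"
      by (rule period_dvd, rule mat_power_add_pos[OF assms(1) m n])
    moreover have "period A i dvd (m + k) + n"
      by (rule period_dvd, rule mat_power_add_pos[OF assms(1)
          mat_power_add_pos[OF assms(1) m k] n])
    ultimately show "period A i dvd k"
      by (metis add.assoc add.commute dvd_add_right_iff)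
  qed
  then show ?thesis by (simp add: dvd_antisym)
qed

lemma period_pos:
  assumes "irreducible_mat A"
  shows "0 < period A l"
proof -
  obtain k where "k \<ge> 1" "0 < mat_power A k $ l $ l"
    using assms unfolding irreducible_mat_def by blast
  then show ?thesis
    using period_dvd[of A k l] by (auto intro: Nat.gr0I)
qed

lemma cyclic_numbering_path:
  assumes nonneg: "\<And>i j. 0 \<le> A $ i $ j" and irr: "irreducible_mat A"
    and c: "cyclic_numbering A c"
    and pos: "0 < mat_power A k $ i $ j"
  shows "c j = (c i + k) mod period A i"
  using pos
proof (induction k arbitrary: i)
  case 0
  then have "i = j" by (simp add: mat_def split: if_splits)
  then show ?case using c by (simp add: cyclic_numbering_def)
next
  case (Suc k)
  have "0 < (\<Sum>h\<in>UNIV. A $ i $ h * mat_power A k $ h $ j)"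
    using Suc.prems by (simp add: matrix_matrix_mult_def)
  then obtain h where h: "0 < A $ i $ h * mat_power A k $ h $ j"
    by (metis (no_types, lifting) not_less sum_nonpos)
  then have "0 < mat_power A k $ h $ j" "A $ i $ h \<noteq> 0"
    using nonneg[of i h] mat_power_nonneg[OF nonneg, of k h j]
    by (auto simp: zero_less_mult_iff)
  then have "c j = (c h + k) mod period A h" "c h = (c i + 1) mod period A i"
    using Suc.IH c by (auto simp: cyclic_numbering_def)
  then show ?case
    using period_indep[OF nonneg irr, of h i] by (simp add: mod_simps)
qed

lemma same_cyclic_class_iff:
  assumes nonneg: "\<And>i j. 0 \<le> A $ i $ j" and irr: "irreducible_mat A"
    and c: "cyclic_numbering A c"
  shows "same_cyclic_class A i j \<longleftrightarrow> c i = c j"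
proof
  assume "same_cyclic_class A i j"
  then obtain k where "0 < mat_power A (period A i * k) $ i $ j"
    by (auto simp: same_cyclic_class_def communicate_def mat_power_mult)
  from cyclic_numbering_path[OF nonneg irr c this]
  show "c i = c j" using c by (simp add: cyclic_numbering_def)
next
  assume eq: "c i = c j"
  have ex: "\<exists>k. 0 < mat_power (mat_power A (period A i)) k $ a $ b"
    if "c a = c b" for a b
  proof -
    obtain k where k: "0 < mat_power A k $ a $ b"
      using irr unfolding irreducible_mat_def by blast
    have p: "period A a = period A i" by (rule period_indep[OF nonneg irr])
    have "c a < period A a" using c by (simp add: cyclic_numbering_def)
    moreover have "c a = (c a + k) mod period A a"
      using cyclic_numbering_path[OF nonneg irr c k] that by simp
    ultimately have "(c a + k) mod period A a = (c a + 0) mod period A a" by simp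
    then have "period A a dvd (c a + k) - c a"
      by (metis add.right_neutral le_add1 mod_eq_dvd_iff_nat)
    then have "period A i dvd k" by (simp add: p)
    then show ?thesis using k by (metis dvdE mat_power_mult)
  qed
  show "same_cyclic_class A i j"
    unfolding same_cyclic_class_def communicate_def using ex eq by simp
qed

lemma cyclic_numbering_exists:
  fixes A :: "real^'n^'n"
  assumes nonneg: "\<And>i j. 0 \<le> A $ i $ j" and irr: "irreducible_mat A"
  shows "\<exists>c. cyclic_numbering A c"
proof -
  define a :: 'n where "a = undefined"
  define q where "q i = (SOME k. 0 < mat_power A k $ a $ i)" for i
  have q: "0 < mat_power A (q i) $ a $ i" for i
    unfolding q_def by (rule someI_ex) (use irr in \<open>auto simp: irreducible_mat_def\<close>)
  have cong: "k mod period A a = m mod period A a"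
    if k: "0 < mat_power A k $ a $ i" and m: "0 < mat_power A m $ a $ i" for k m i
  proof -
    obtain n where n: "0 < mat_power A n $ i $ a"
      using irr unfolding irreducible_mat_def by blast
    have "period A a dvd k + n" "period A a dvd m + n"
      by (auto intro!: period_dvd mat_power_add_pos[OF nonneg _ n] k m)
    then have "(k + (m + n)) mod period A a = k mod period A a"
      "(m + (k + n)) mod period A a = m mod period A a"
      by (auto elim!: dvdE)
    then show ?thesis by (simp add: ac_simps)
  qed
  have "cyclic_numbering A (\<lambda>i. q i mod period A a)"
    unfolding cyclic_numbering_def
  proof (intro conjI allI impI)
    fix i show "q i mod period A a < period A i"
      using period_pos[OF irr] period_indep[OF nonneg irr, of a i] by simp
  next
    fix i j
    assume ne: "q j mod period A a \<noteq> (q i mod period A a + 1) mod period A i"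
    show "A $ i $ j = 0"
    proof (rule ccontr)
      assume "A $ i $ j \<noteq> 0"
      then have "0 < mat_power A 1 $ i $ j"
        using nonneg[of i j] by (simp add: less_le)
      from mat_power_add_pos[OF nonneg q this]
      have "q j mod period A a = (q i + 1) mod period A a"
        using cong q by blast
      then show False
        using ne period_indep[OF nonneg irr, of a i] by (simp add: mod_simps)
    qed
  qed
  then show ?thesis by blast
qed


section \<open>Conditional probability and conditional independence\<close>

definition prob_given :: "'a measure \<Rightarrow> 'a measure \<Rightarrow> 'a set \<Rightarrow> 'a \<Rightarrow> real" where
  "prob_given M F E = real_cond_exp M F (indicator E)"

definition cond_indep_vars ::
  "'a measure \<Rightarrow> 'a measure \<Rightarrow> ('i \<Rightarrow> 'b measure) \<Rightarrow> ('i \<Rightarrow> 'a \<Rightarrow> 'b) \<Rightarrow> 'i set \<Rightarrow> bool" where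
  "cond_indep_vars M F N Y I \<longleftrightarrow>
     (\<forall>i\<in>I. Y i \<in> measurable M (N i)) \<and>
     (\<forall>J B. J \<subseteq> I \<longrightarrow> finite J \<longrightarrow> (\<forall>j\<in>J. B j \<in> sets (N j)) \<longrightarrow>
        (AE \<omega> in M. prob_given M F {\<omega> \<in> space M. \<forall>j\<in>J. Y j \<omega> \<in> B j} \<omega> =
           (\<Prod>j\<in>J. prob_given M F {\<omega> \<in> space M. Y j \<omega> \<in> B j} \<omega>)))"


section \<open>The process\<close>

text \<open>The $\sigma$-algebra generated by the coordinates of \<open>Z\<^sub>0\<close> and of \<open>X\<^sub>1, \<dots>, X\<^sub>n\<close>.\<close>

definition history ::
  "'a measure \<Rightarrow> (nat \<Rightarrow> 'a \<Rightarrow> real^'n) \<Rightarrow> (nat \<Rightarrow> 'a \<Rightarrow> real^'n) \<Rightarrow> nat \<Rightarrow> 'a measure" where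
  "history M Z X n = sigma (space M)
     ({{\<omega> \<in> space M. Z 0 \<omega> $ l \<in> B} | l B. B \<in> sets borel} \<union>
      {{\<omega> \<in> space M. X k \<omega> $ l \<in> B} | k l B. 1 \<le> k \<and> k \<le> n \<and> B \<in> sets borel})"

text \<open>The decomposition of a vector \<open>z\<close> induced by a nonnegative irreducible matrix \<open>A\<close>
  (below \<open>A = transpose W\<close>) and its normalised left Perron eigenvector \<open>v\<close>.\<close>

definition part1 :: "real^'n \<Rightarrow> real^'n \<Rightarrow> real^'n" where
  "part1 v z = (v \<bullet> z) *\<^sub>R 1"

definition class_mean :: "real^'n^'n \<Rightarrow> real^'n \<Rightarrow> real^'n \<Rightarrow> real^'n" where
  "class_mean A v z = (\<chi> l. \<Sum>l1 | same_cyclic_class A l1 l.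
     v $ l1 / (\<Sum>l2 | same_cyclic_class A l2 l. v $ l2) * z $ l1)"

definition part2 :: "real^'n^'n \<Rightarrow> real^'n \<Rightarrow> real^'n \<Rightarrow> real^'n" where
  "part2 A v z = class_mean A v z - (v \<bullet> z) *\<^sub>R 1"

definition part3 :: "real^'n^'n \<Rightarrow> real^'n \<Rightarrow> real^'n \<Rightarrow> real^'n" where
  "part3 A v z = z - part1 v z - part2 A v z"

end

theory Submission
  imports Defs
begin

text \<open>
  Convergence is pathwise, since the increments at step \<open>n\<close> are bounded by \<open>r n\<close>.

  For the second claim fix distinct vertices \<open>a\<close>, \<open>b\<close> and a time \<open>n\<close>, and let
  \<open>\<xi> = X\<^sub>n\<^sub>+\<^sub>1\<^sub>,\<^sub>a - p\<close>, where \<open>p\<close> is the conditional probability of \<open>X\<^sub>n\<^sub>+\<^sub>1\<^sub>,\<^sub>a = 1\<close>. The vector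
  \<open>E[\<xi> Z\<^sub>m]\<close> equals \<open>s\<close> times the unit vector at \<open>a\<close> for \<open>m = n + 1\<close>, where \<open>s = r\<^sub>n E[p (1 - p)]\<close>,
  and afterwards it evolves deterministically by averaging along \<open>W\<close> with weights \<open>r\<^sub>m\<close>. When the
  remaining weights sum to at most \<open>1/4\<close>, its entries at \<open>a\<close> and \<open>b\<close> differ by at least \<open>s/2\<close>
  for all later times. If the two limits were almost surely equal, then \<open>s = 0\<close>, so \<open>p\<close> would be \<open>0\<close> or \<open>1\<close>
  almost surely for all late \<open>n\<close>. This forces the neighbours of \<open>a\<close>, and by irreducibility all vertices,
  to share the value \<open>p\<close>. Extreme values cannot be entered
  in finite time, so already \<open>Z\<^sub>0\<close> would be almost surely the zero or the all-ones vector.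
\<close>

section \<open>Convergence of a single path and of its decomposition\<close>

lemma vec_convergentI:
  fixes f :: "nat \<Rightarrow> 'b::t2_space^'n"
  assumes "\<And>l. convergent (\<lambda>n. f n $ l)"
  shows "convergent f"
proof -
  have "f \<longlonglongrightarrow> (\<chi> l. lim (\<lambda>n. f n $ l))"
    by (rule vec_tendstoI) (use assms in \<open>simp add: convergent_LIMSEQ_iff\<close>)
  then show ?thesis by (rule convergentI)
qed

lemma convergent_part1:
  assumes "convergent z"
  shows "convergent (\<lambda>n. part1 v (z n))"
proof -
  obtain a where "z \<longlonglongrightarrow> a" using assms by (auto simp: convergent_def)
  then have "(\<lambda>n. part1 v (z n)) \<longlonglongrightarrow> part1 v a"
    unfolding part1_def by (intro tendsto_intros)
  then show ?thesis by (rule convergentI)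
qed

text \<open>For fixed \<open>A\<close> and \<open>v\<close> the weights are constants, so every
  entry of the class mean is a fixed linear form in the entries of \<open>z\<close>.\<close>

lemma convergent_class_mean:
  assumes "convergent z"
  shows "convergent (\<lambda>n. class_mean A v (z n))"
proof -
  obtain a where "z \<longlonglongrightarrow> a" using assms by (auto simp: convergent_def)
  then have "(\<lambda>n. class_mean A v (z n)) \<longlonglongrightarrow> class_mean A v a"
    unfolding class_mean_def by (intro tendsto_intros)
  then show ?thesis by (rule convergentI)
qed

lemma convergent_part2: "convergent z \<Longrightarrow> convergent (\<lambda>n. part2 A v (z n))"
  unfolding part2_def part1_def[symmetric]
  by (intro convergent_diff convergent_class_mean convergent_part1)

lemma convergent_part3: "convergent z \<Longrightarrow> convergent (\<lambda>n. part3 A v (z n))"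
  unfolding part3_def by (intro convergent_diff convergent_part1 convergent_part2)

lemma convergent_if_summable_increments:
  fixes f :: "nat \<Rightarrow> 'b::banach"
  assumes "summable r" and "\<And>n. norm (f (Suc n) - f n) \<le> r n"
  shows "convergent f"
proof -
  have "summable (\<lambda>n. f (Suc n) - f n)"
    by (rule summable_comparison_test'[OF assms(1)]) (rule assms(2))
  then have "convergent (\<lambda>n. \<Sum>k<n. f (Suc k) - f k)"
    by (simp add: summable_iff_convergent)
  then have "convergent (\<lambda>n. (\<Sum>k<n. f (Suc k) - f k) + f 0)"
    by (rule convergent_add) (rule convergent_const)
  then show ?thesis by (simp add: sum_lessThan_telescope)
qed

section \<open>Deterministic averaging along the weights\<close>

text \<open>By \<open>transpose W *v 1 = 1\<close> each column of \<open>W\<close> sums to one, so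
  the entries of \<open>transpose W *v x\<close> are convex combinations of those of
  \<open>x\<close>.\<close>

lemma transpose_mult_range:
  fixes W :: "real^'n^'n"
  assumes W: "\<And>i j. 0 \<le> W $ i $ j" "transpose W *v 1 = 1"
    and x: "\<And>i. x $ i \<in> {0..s}"
  shows "(transpose W *v x) $ l \<in> {0..s}"
proof -
  have mult: "(transpose W *v y) $ l = (\<Sum>i\<in>UNIV. W $ i $ l * y $ i)" for y
    by (simp add: matrix_vector_mult_def transpose_def)
  have "(\<Sum>i\<in>UNIV. W $ i $ l) = 1"
    using W(2) mult[of 1] by simp
  then have "(\<Sum>i\<in>UNIV. W $ i $ l * s) = s"
    by (simp add: sum_distrib_right[symmetric])
  moreover have "(transpose W *v x) $ l \<le> (\<Sum>i\<in>UNIV. W $ i $ l * s)"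
    unfolding mult by (intro sum_mono mult_left_mono W(1)) (use x in auto)
  moreover have "0 \<le> (transpose W *v x) $ l"
    unfolding mult by (intro sum_nonneg mult_nonneg_nonneg W(1)) (use x in auto)
  ultimately show ?thesis by simp
qed

lemma convex_combination_range:
  fixes x y s t :: real
  assumes "x \<in> {0..s}" "y \<in> {0..s}" "0 \<le> t" "t \<le> 1"
  shows "(1 - t) * x + t * y \<in> {0..s}"
  using convex_bound_le[of x s y "1 - t" t] assms by auto

text \<open>The iteration keeps the entries in \<open>[0, s]\<close>, so over steps of small total weight the
  entry at \<open>a\<close> loses little and the entry at \<open>b\<close> gains little.\<close>

lemma averaging_iteration_separates:
  fixes W :: "real^'n^'n" and u :: "nat \<Rightarrow> real^'n"
  assumes W: "\<And>i j. 0 \<le> W $ i $ j" "transpose W *v 1 = 1"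
    and r: "\<And>n. 0 \<le> r n" "\<And>n. r n \<le> 1"
    and u_0: "\<And>l. u 0 $ l = (if l = a then s else 0)" and s: "0 \<le> s"
    and u_Suc: "\<And>k. u (Suc k) = (1 - r k) *\<^sub>R u k + r k *\<^sub>R (transpose W *v u k)"
    and "b \<noteq> a"
  shows "s * (1 - 2 * (\<Sum>k<m. r k)) \<le> u m $ a - u m $ b"
proof -
  have range: "u m $ l \<in> {0..s}" for m l
  proof (induction m arbitrary: l)
    case 0
    then show ?case using s by (simp add: u_0)
  next
    case (Suc m)
    show ?case
      using convex_combination_range[OF Suc transpose_mult_range[OF W Suc] r] by (simp add: u_Suc)
  qed
  have "s * (1 - (\<Sum>k<m. r k)) \<le> u m $ a \<and> u m $ b \<le> s * (\<Sum>k<m. r k)"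
  proof (induction m)
    case 0
    then show ?case using \<open>b \<noteq> a\<close> by (simp add: u_0)
  next
    case (Suc m)
    note avg_range = transpose_mult_range[OF W range]
    have "r m * u m $ a \<le> r m * s" "0 \<le> r m * (transpose W *v u m) $ a"
      "0 \<le> r m * u m $ b" "r m * (transpose W *v u m) $ b \<le> r m * s"
      using r range[of m a] range[of m b] avg_range[of m a] avg_range[of m b]
      by (auto intro!: mult_left_mono mult_nonneg_nonneg)
    with Suc show ?case by (simp add: u_Suc algebra_simps)
  qed
  then show ?thesis by (simp add: algebra_simps)
qed

section \<open>The network process: ranges, filtration, measurability\<close>

locale reinforced_network = prob_space M
  for M :: "'a measure" and W :: "real^'n^'n" and r :: "nat \<Rightarrow> real"
    and Z X :: "nat \<Rightarrow> 'a \<Rightarrow> real^'n" +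
  assumes W_nonneg: "\<And>i j. 0 \<le> W $ i $ j"
    and W_one: "transpose W *v 1 = 1"
    and r_pos: "\<And>n. 0 < r n" and r_less_1: "\<And>n. r n < 1"
    and Z_0_measurable: "Z 0 \<in> borel_measurable M"
    and Z_0_range: "\<And>\<omega> l. \<omega> \<in> space M \<Longrightarrow> Z 0 \<omega> $ l \<in> {0..1}"
    and X_range: "\<And>n \<omega> l. \<omega> \<in> space M \<Longrightarrow> X (Suc n) \<omega> $ l \<in> {0, 1}"
    and X_indep: "\<And>n. cond_indep_vars M (history M Z X n) (\<lambda>_. borel)
                         (\<lambda>l \<omega>. X (Suc n) \<omega> $ l) UNIV"
    and X_prob: "\<And>n l. AE \<omega> in M.
           prob_given M (history M Z X n) {\<omega> \<in> space M. X (Suc n) \<omega> $ l = 1} \<omega> =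
           (transpose W *v Z n \<omega>) $ l"
    and Z_Suc: "\<And>n \<omega>. \<omega> \<in> space M \<Longrightarrow>
           Z (Suc n) \<omega> = (1 - r n) *\<^sub>R Z n \<omega> + r n *\<^sub>R X (Suc n) \<omega>"
begin

text \<open>By \<open>X_prob\<close> this is a version of the conditional probability of a draw
  equal to one. Unlike \<open>prob_given\<close>, it is an explicit function of \<open>Z n\<close>,
  so its bounds hold at every point.\<close>

definition p :: "nat \<Rightarrow> 'n \<Rightarrow> 'a \<Rightarrow> real" where
  "p n l \<omega> = (transpose W *v Z n \<omega>) $ l"

abbreviation F :: "nat \<Rightarrow> 'a measure" where
  "F n \<equiv> history M Z X n"

lemma p_eq: "p n l \<omega> = (\<Sum>i\<in>UNIV. W $ i $ l * Z n \<omega> $ i)"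
  by (simp add: p_def matrix_vector_mult_def transpose_def)

lemma Z_Suc_nth:
  "\<omega> \<in> space M \<Longrightarrow> Z (Suc n) \<omega> $ l = (1 - r n) * Z n \<omega> $ l + r n * X (Suc n) \<omega> $ l"
  by (simp add: Z_Suc)

lemma Z_range: "\<omega> \<in> space M \<Longrightarrow> Z n \<omega> $ l \<in> {0..1}"
proof (induction n)
  case 0
  then show ?case by (rule Z_0_range)
next
  case (Suc n)
  have "X (Suc n) \<omega> $ l \<in> {0..1}"
    using X_range[OF Suc.prems, of n l] by auto
  from convex_combination_range[OF Suc.IH[OF Suc.prems] this, of "r n"]
  show ?case
    using r_pos[of n] r_less_1[of n] by (simp add: Z_Suc_nth[OF Suc.prems])
qed

lemma p_range: "\<omega> \<in> space M \<Longrightarrow> p n l \<omega> \<in> {0..1}"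
  unfolding p_def by (rule transpose_mult_range[OF W_nonneg W_one Z_range])

lemma X_nth_measurable [measurable]: "(\<lambda>\<omega>. X (Suc n) \<omega> $ l) \<in> borel_measurable M"
  using X_indep[of n] by (simp add: cond_indep_vars_def)

lemma space_F [simp]: "space (F n) = space M"
  unfolding history_def by (rule space_measure_of) auto

lemma sets_F:
  "sets (F n) = sigma_sets (space M)
     ({{\<omega> \<in> space M. Z 0 \<omega> $ l \<in> B} | l B. B \<in> sets borel} \<union>
      {{\<omega> \<in> space M. X k \<omega> $ l \<in> B} | k l B. 1 \<le> k \<and> k \<le> n \<and> B \<in> sets borel})"
  unfolding history_def by (rule sets_measure_of) auto

lemma subalgebra_F: "subalgebra M (F n)"
  unfolding subalgebra_def sets_F
proof (intro conjI sets.sigma_sets_subset subsetI)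
  fix A
  assume "A \<in> {{\<omega> \<in> space M. Z 0 \<omega> $ l \<in> B} | l B. B \<in> sets borel} \<union>
      {{\<omega> \<in> space M. X k \<omega> $ l \<in> B} | k l B. 1 \<le> k \<and> k \<le> n \<and> B \<in> sets borel}"
  then consider l B where "B \<in> sets borel" "A = {\<omega> \<in> space M. Z 0 \<omega> $ l \<in> B}"
    | k l B where "1 \<le> k" "B \<in> sets borel" "A = {\<omega> \<in> space M. X k \<omega> $ l \<in> B}"
    by blast
  then show "A \<in> sets M"
  proof cases
    case 1
    have "(\<lambda>\<omega>. Z 0 \<omega> $ l) \<in> borel_measurable M"
      by (intro measurable_compose[OF Z_0_measurable] borel_measurable_continuous_onI
          continuous_intros)
    from measurable_sets[OF this 1(1)] show ?thesis
      by (simp add: 1 vimage_def Int_def conj_commute)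
  next
    case 2
    \<comment> \<open>Nothing is known about \<open>X 0\<close>; the bound \<open>1 \<le> k\<close>
      in the generators excludes it.\<close>
    then obtain j where j: "k = Suc j" by (cases k) auto
    show ?thesis
      using measurable_sets[OF X_nth_measurable 2(2), of j l]
      by (simp add: 2(3) j vimage_def Int_def conj_commute)
  qed
qed simp

lemma F_mono: "m \<le> n \<Longrightarrow> sets (F m) \<subseteq> sets (F n)"
  unfolding sets_F by (intro sigma_sets_mono' Un_mono order_refl) (blast intro: order_trans)

lemma measurable_F_mono:
  assumes "f \<in> borel_measurable (F m)" and "m \<le> n"
  shows "f \<in> borel_measurable (F n)"
  using assms F_mono[OF assms(2)] by (auto simp: measurable_def)

lemma X_F: "1 \<le> k \<Longrightarrow> k \<le> n \<Longrightarrow> (\<lambda>\<omega>. X k \<omega> $ l) \<in> borel_measurable (F n)"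
proof (rule measurableI)
  fix B :: "real set" assume "B \<in> sets borel"
  moreover assume "1 \<le> k" "k \<le> n"
  ultimately have "{\<omega> \<in> space M. X k \<omega> $ l \<in> B} \<in> sets (F n)"
    unfolding sets_F by (intro sigma_sets.Basic) blast
  then show "(\<lambda>\<omega>. X k \<omega> $ l) -` B \<inter> space (F n) \<in> sets (F n)"
    by (simp add: vimage_def Int_def conj_commute)
qed simp

lemma Z_F: "(\<lambda>\<omega>. Z n \<omega> $ l) \<in> borel_measurable (F n)"
proof (induction n)
  case 0
  show ?case
  proof (rule measurableI)
    fix B :: "real set" assume "B \<in> sets borel"
    then have "{\<omega> \<in> space M. Z 0 \<omega> $ l \<in> B} \<in> sets (F 0)"
      unfolding sets_F by (intro sigma_sets.Basic) blast
    then show "(\<lambda>\<omega>. Z 0 \<omega> $ l) -` B \<inter> space (F 0) \<in> sets (F 0)"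
      by (simp add: vimage_def Int_def conj_commute)
  qed simp
next
  case (Suc n)
  have "(\<lambda>\<omega>. (1 - r n) * Z n \<omega> $ l + r n * X (Suc n) \<omega> $ l) \<in> borel_measurable (F (Suc n))"
    by (intro borel_measurable_add borel_measurable_times borel_measurable_const
        measurable_F_mono[OF Suc] X_F) auto
  then show ?case
    by (rule measurable_cong[THEN iffD1, rotated]) (simp add: Z_Suc_nth)
qed

lemma p_F: "p n l \<in> borel_measurable (F n)"
  unfolding p_eq[abs_def]
  by (intro borel_measurable_sum borel_measurable_times borel_measurable_const Z_F)

lemma F_imp_M: "f \<in> borel_measurable (F n) \<Longrightarrow> f \<in> borel_measurable M"
  by (rule measurable_from_subalg[OF subalgebra_F])

lemmas Z_nth_measurable [measurable] = Z_F[THEN F_imp_M]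
  and p_measurable [measurable] = p_F[THEN F_imp_M]

lemma sigma_finite_F: "sigma_finite_subalgebra M (F n)"
proof -
  interpret finite_measure_subalgebra M "F n"
    by unfold_locales (rule subalgebra_F)
  show ?thesis by unfold_locales
qed

section \<open>Integrals of draws against the past\<close>

lemma bounded_integrable:
  fixes f :: "'a \<Rightarrow> real"
  assumes "f \<in> borel_measurable M" and "\<And>\<omega>. \<omega> \<in> space M \<Longrightarrow> \<bar>f \<omega>\<bar> \<le> C"
  shows "integrable M f"
  by (rule integrable_const_bound[of _ C]) (use assms in auto)

text \<open>The characteristic property of conditional expectation. Boundedness of \<open>g\<close>
  supplies the integrability, and any measurable version \<open>q\<close> of the conditional
  probability may be inserted under the integral.\<close>

lemma integral_mult_prob_given:
  assumes g: "g \<in> borel_measurable (F n)" and C: "\<And>\<omega>. \<omega> \<in> space M \<Longrightarrow> \<bar>g \<omega>\<bar> \<le> C"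
    and E: "E \<in> sets M" and ae: "AE \<omega> in M. prob_given M (F n) E \<omega> = q \<omega>"
    and q: "q \<in> borel_measurable M"
  shows "(\<integral>\<omega>. g \<omega> * indicator E \<omega> \<partial>M) = (\<integral>\<omega>. g \<omega> * q \<omega> \<partial>M)"
proof -
  interpret sigma_finite_subalgebra M "F n" by (rule sigma_finite_F)
  note [measurable] = F_imp_M[OF g] E q
  have "integrable M (\<lambda>\<omega>. g \<omega> * indicator E \<omega>)"
    by (rule bounded_integrable[of _ C])
      (use C in \<open>auto simp: indicator_def intro: order_trans[OF abs_ge_zero]\<close>)
  from real_cond_exp_intg(2)[OF this g]
  have "(\<integral>\<omega>. g \<omega> * indicator E \<omega> \<partial>M) = (\<integral>\<omega>. g \<omega> * real_cond_exp M (F n) (indicator E) \<omega> \<partial>M)"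
    by simp
  also have "\<dots> = (\<integral>\<omega>. g \<omega> * q \<omega> \<partial>M)"
    by (rule integral_cong_AE) (use ae in \<open>auto simp: prob_given_def\<close>)
  finally show ?thesis .
qed

lemma X_eq_indicator:
  "\<omega> \<in> space M \<Longrightarrow> X (Suc n) \<omega> $ l = indicator {\<omega> \<in> space M. X (Suc n) \<omega> $ l = 1} \<omega>"
  using X_range[of \<omega> n l] by (auto simp: indicator_def)

lemma X_prob_p:
  "AE \<omega> in M. prob_given M (F n) {\<omega> \<in> space M. X (Suc n) \<omega> $ l = 1} \<omega> = p n l \<omega>"
  unfolding p_def by (rule X_prob)

lemma integral_mult_X:
  assumes g: "g \<in> borel_measurable (F n)" "\<And>\<omega>. \<omega> \<in> space M \<Longrightarrow> \<bar>g \<omega>\<bar> \<le> C"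
  shows "(\<integral>\<omega>. g \<omega> * X (Suc n) \<omega> $ l \<partial>M) = (\<integral>\<omega>. g \<omega> * p n l \<omega> \<partial>M)"
proof -
  let ?E = "{\<omega> \<in> space M. X (Suc n) \<omega> $ l = 1}"
  have "(\<integral>\<omega>. g \<omega> * X (Suc n) \<omega> $ l \<partial>M) = (\<integral>\<omega>. g \<omega> * indicator ?E \<omega> \<partial>M)"
    by (intro Bochner_Integration.integral_cong arg_cong2[where f = "(*)"] X_eq_indicator) simp_all
  also have "\<dots> = (\<integral>\<omega>. g \<omega> * p n l \<omega> \<partial>M)"
    by (rule integral_mult_prob_given[OF g]) (simp_all add: X_prob_p)
  finally show ?thesis .
qed

text \<open>For draws in \<open>{0, 1}\<close> the product is the indicator that both equal one, and
  conditional independence factorises the conditional probability of this event.\<close>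

lemma integral_X_mult_X:
  assumes "a \<noteq> b"
  shows "(\<integral>\<omega>. X (Suc n) \<omega> $ a * X (Suc n) \<omega> $ b \<partial>M) = (\<integral>\<omega>. p n a \<omega> * p n b \<omega> \<partial>M)"
proof -
  let ?E = "{\<omega> \<in> space M. \<forall>j\<in>{a, b}. X (Suc n) \<omega> $ j \<in> {1}}"
  have E: "?E \<in> sets M" by measurable
  have "AE \<omega> in M. prob_given M (F n) ?E \<omega> =
      (\<Prod>j\<in>{a, b}. prob_given M (F n) {\<omega> \<in> space M. X (Suc n) \<omega> $ j \<in> {1}} \<omega>)"
    using X_indep[of n] unfolding cond_indep_vars_def
    by (elim conjE allE[of _ "{a, b}"] allE[of _ "\<lambda>_. {1}"]) auto
  with X_prob[of n a] X_prob[of n b]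
  have ae: "AE \<omega> in M. prob_given M (F n) ?E \<omega> = p n a \<omega> * p n b \<omega>"
    by eventually_elim (use assms in \<open>simp add: p_def\<close>)
  have "(\<integral>\<omega>. X (Suc n) \<omega> $ a * X (Suc n) \<omega> $ b \<partial>M) = (\<integral>\<omega>. 1 * indicator ?E \<omega> \<partial>M)"
  proof (rule Bochner_Integration.integral_cong)
    fix \<omega> assume "\<omega> \<in> space M"
    then show "X (Suc n) \<omega> $ a * X (Suc n) \<omega> $ b = 1 * indicator ?E \<omega>"
      using X_range[of \<omega> n a] X_range[of \<omega> n b] by (auto simp: indicator_def)
  qed simp
  also have "\<dots> = (\<integral>\<omega>. 1 * (p n a \<omega> * p n b \<omega>) \<partial>M)"
    by (rule integral_mult_prob_given[OF _ _ E ae, of _ 1]) simp_all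
  finally show ?thesis by simp
qed

section \<open>The centred draw and its covariance with the later process\<close>

text \<open>A martingale difference: orthogonal to bounded variables known at time \<open>n\<close>,
  yet itself known from time \<open>Suc n\<close> on, so it can serve as the factor \<open>g\<close>
  in \<open>integral_mult_X\<close> at all later times.\<close>

definition \<xi> :: "nat \<Rightarrow> 'n \<Rightarrow> 'a \<Rightarrow> real" where
  "\<xi> n a \<omega> = X (Suc n) \<omega> $ a - p n a \<omega>"

lemma \<xi>_F: "\<xi> n a \<in> borel_measurable (F (Suc n))"
  unfolding \<xi>_def[abs_def]
  by (intro borel_measurable_diff X_F measurable_F_mono[OF p_F]) auto

lemmas \<xi>_measurable [measurable] = \<xi>_F[THEN F_imp_M]

lemma abs_le_one:
  assumes "\<omega> \<in> space M"
  shows "\<bar>X (Suc n) \<omega> $ l\<bar> \<le> 1" "\<bar>Z n \<omega> $ l\<bar> \<le> 1" "\<bar>p n l \<omega>\<bar> \<le> 1" "\<bar>\<xi> n l \<omega>\<bar> \<le> 1"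
  using X_range[OF assms, of n l] Z_range[OF assms, of n l] p_range[OF assms, of n l]
  by (auto simp: \<xi>_def)

lemma abs_mult_le_one: "\<bar>x\<bar> \<le> 1 \<Longrightarrow> \<bar>y\<bar> \<le> 1 \<Longrightarrow> \<bar>x * y\<bar> \<le> (1::real)"
  unfolding abs_mult by (rule mult_le_one) auto

lemmas integrable_mult =
  bounded_integrable[OF borel_measurable_times abs_mult_le_one]

lemma integrable_\<xi>_mult:
  "integrable M (\<lambda>\<omega>. \<xi> n a \<omega> * Z m \<omega> $ l)"
  "integrable M (\<lambda>\<omega>. \<xi> n a \<omega> * X (Suc m) \<omega> $ l)"
  by (rule integrable_mult, auto intro: abs_le_one)+

lemma integral_\<xi>_mult_Z: "(\<integral>\<omega>. \<xi> n a \<omega> * Z n \<omega> $ l \<partial>M) = 0"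
proof -
  have "(\<integral>\<omega>. Z n \<omega> $ l * X (Suc n) \<omega> $ a \<partial>M) = (\<integral>\<omega>. Z n \<omega> $ l * p n a \<omega> \<partial>M)"
    by (rule integral_mult_X[OF Z_F abs_le_one(2)])
  moreover have "(\<integral>\<omega>. \<xi> n a \<omega> * Z n \<omega> $ l \<partial>M) =
      (\<integral>\<omega>. Z n \<omega> $ l * X (Suc n) \<omega> $ a - Z n \<omega> $ l * p n a \<omega> \<partial>M)"
    by (simp add: \<xi>_def algebra_simps)
  moreover have "\<dots> = (\<integral>\<omega>. Z n \<omega> $ l * X (Suc n) \<omega> $ a \<partial>M) - (\<integral>\<omega>. Z n \<omega> $ l * p n a \<omega> \<partial>M)"
    by (intro Bochner_Integration.integral_diff integrable_mult) (auto intro: abs_le_one)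
  ultimately show ?thesis by simp
qed

text \<open>Off the diagonal, conditional independence makes the two terms cancel. On the diagonal
  the square of a draw is the draw itself, which leaves the expected conditional variance of a
  Bernoulli variable.\<close>

lemma integral_\<xi>_mult_X:
  "(\<integral>\<omega>. \<xi> n a \<omega> * X (Suc n) \<omega> $ l \<partial>M) =
     (if l = a then (\<integral>\<omega>. p n a \<omega> * (1 - p n a \<omega>) \<partial>M) else 0)"
proof -
  have pX: "(\<integral>\<omega>. p n a \<omega> * X (Suc n) \<omega> $ l \<partial>M) = (\<integral>\<omega>. p n a \<omega> * p n l \<omega> \<partial>M)"
    by (rule integral_mult_X[OF p_F abs_le_one(3)])
  have split: "(\<integral>\<omega>. \<xi> n a \<omega> * X (Suc n) \<omega> $ l \<partial>M) =
      (\<integral>\<omega>. X (Suc n) \<omega> $ a * X (Suc n) \<omega> $ l \<partial>M) - (\<integral>\<omega>. p n a \<omega> * X (Suc n) \<omega> $ l \<partial>M)"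
  proof -
    have "(\<integral>\<omega>. \<xi> n a \<omega> * X (Suc n) \<omega> $ l \<partial>M) =
        (\<integral>\<omega>. X (Suc n) \<omega> $ a * X (Suc n) \<omega> $ l - p n a \<omega> * X (Suc n) \<omega> $ l \<partial>M)"
      by (simp add: \<xi>_def left_diff_distrib)
    also have "\<dots> = (\<integral>\<omega>. X (Suc n) \<omega> $ a * X (Suc n) \<omega> $ l \<partial>M) - (\<integral>\<omega>. p n a \<omega> * X (Suc n) \<omega> $ l \<partial>M)"
      by (intro Bochner_Integration.integral_diff integrable_mult) (auto intro: abs_le_one)
    finally show ?thesis .
  qed
  show ?thesis
  proof (cases "l = a")
    case False
    then show ?thesis using integral_X_mult_X[of a l n] pX split by simp
  next
    case True
    have "(\<integral>\<omega>. X (Suc n) \<omega> $ a * X (Suc n) \<omega> $ a \<partial>M) = (\<integral>\<omega>. 1 * X (Suc n) \<omega> $ a \<partial>M)"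
    proof (rule Bochner_Integration.integral_cong)
      fix \<omega> assume "\<omega> \<in> space M"
      then show "X (Suc n) \<omega> $ a * X (Suc n) \<omega> $ a = 1 * X (Suc n) \<omega> $ a"
        using X_range[of \<omega> n a] by auto
    qed simp
    also have "\<dots> = (\<integral>\<omega>. 1 * p n a \<omega> \<partial>M)"
      by (rule integral_mult_X[of _ _ 1]) auto
    finally have "(\<integral>\<omega>. \<xi> n a \<omega> * X (Suc n) \<omega> $ l \<partial>M) =
        (\<integral>\<omega>. 1 * p n a \<omega> \<partial>M) - (\<integral>\<omega>. p n a \<omega> * p n a \<omega> \<partial>M)"
      using split pX True by simp
    also have "\<dots> = (\<integral>\<omega>. 1 * p n a \<omega> - p n a \<omega> * p n a \<omega> \<partial>M)"
      by (intro Bochner_Integration.integral_diff[symmetric] integrable_mult)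
        (auto intro: abs_le_one)
    finally show ?thesis using True by (simp add: algebra_simps)
  qed
qed

text \<open>Since \<open>\<xi> n a\<close> has mean zero, these mixed moments are
  covariances.\<close>

definition cov :: "nat \<Rightarrow> 'n \<Rightarrow> nat \<Rightarrow> real^'n" where
  "cov n a m = (\<chi> l. \<integral>\<omega>. \<xi> n a \<omega> * Z m \<omega> $ l \<partial>M)"

lemma cov_step:
  "cov n a (Suc m) $ l = (1 - r m) * cov n a m $ l + r m * (\<integral>\<omega>. \<xi> n a \<omega> * X (Suc m) \<omega> $ l \<partial>M)"
proof -
  have "cov n a (Suc m) $ l =
      (\<integral>\<omega>. (1 - r m) * (\<xi> n a \<omega> * Z m \<omega> $ l) + r m * (\<xi> n a \<omega> * X (Suc m) \<omega> $ l) \<partial>M)"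
    unfolding cov_def vec_lambda_beta
  proof (rule Bochner_Integration.integral_cong)
    fix \<omega> assume "\<omega> \<in> space M"
    then show "\<xi> n a \<omega> * Z (Suc m) \<omega> $ l =
        (1 - r m) * (\<xi> n a \<omega> * Z m \<omega> $ l) + r m * (\<xi> n a \<omega> * X (Suc m) \<omega> $ l)"
      unfolding Z_Suc_nth[OF \<open>\<omega> \<in> space M\<close>] by algebra
  qed simp
  also have "\<dots> = (\<integral>\<omega>. (1 - r m) * (\<xi> n a \<omega> * Z m \<omega> $ l) \<partial>M) +
      (\<integral>\<omega>. r m * (\<xi> n a \<omega> * X (Suc m) \<omega> $ l) \<partial>M)"
    by (rule Bochner_Integration.integral_add) (simp_all add: integrable_\<xi>_mult)
  finally show ?thesis by (simp add: cov_def)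
qed

lemma cov_Suc:
  assumes "n < m"
  shows "cov n a (Suc m) = (1 - r m) *\<^sub>R cov n a m + r m *\<^sub>R (transpose W *v cov n a m)"
proof (rule vec_eq_iff[THEN iffD2, rule_format])
  fix l
  have "\<xi> n a \<in> borel_measurable (F m)"
    by (rule measurable_F_mono[OF \<xi>_F]) (use assms in simp)
  from integral_mult_X[OF this abs_le_one(4)]
  have "(\<integral>\<omega>. \<xi> n a \<omega> * X (Suc m) \<omega> $ l \<partial>M) =
      (\<integral>\<omega>. (\<Sum>i\<in>UNIV. W $ i $ l * (\<xi> n a \<omega> * Z m \<omega> $ i)) \<partial>M)"
    by (simp add: p_eq sum_distrib_left algebra_simps)
  also have "\<dots> = (\<Sum>i\<in>UNIV. \<integral>\<omega>. W $ i $ l * (\<xi> n a \<omega> * Z m \<omega> $ i) \<partial>M)"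
    by (rule Bochner_Integration.integral_sum) (simp add: integrable_\<xi>_mult)
  also have "\<dots> = (transpose W *v cov n a m) $ l"
    by (simp add: matrix_vector_mult_def transpose_def cov_def)
  finally show "cov n a (Suc m) $ l =
      ((1 - r m) *\<^sub>R cov n a m + r m *\<^sub>R (transpose W *v cov n a m)) $ l"
    by (simp add: cov_step)
qed

text \<open>The averaging iteration is started at time \<open>Suc n\<close>: the covariance at time
  \<open>n\<close> vanishes, and the step to \<open>Suc n\<close> adds mass only at
  \<open>a\<close>.\<close>

lemma cov_separates:
  assumes "b \<noteq> a"
  shows "r n * (\<integral>\<omega>. p n a \<omega> * (1 - p n a \<omega>) \<partial>M) * (1 - 2 * (\<Sum>k<m. r (Suc n + k)))
    \<le> cov n a (Suc n + m) $ a - cov n a (Suc n + m) $ b"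
proof (rule averaging_iteration_separates[OF W_nonneg W_one _ _ _ _ _ assms])
  have "0 \<le> (\<integral>\<omega>. p n a \<omega> * (1 - p n a \<omega>) \<partial>M)"
    using p_range by (intro integral_nonneg_AE AE_I2) (auto intro!: mult_nonneg_nonneg)
  then show "0 \<le> r n * (\<integral>\<omega>. p n a \<omega> * (1 - p n a \<omega>) \<partial>M)"
    using r_pos[of n] by simp
  show "cov n a (Suc n + 0) $ l =
      (if l = a then r n * (\<integral>\<omega>. p n a \<omega> * (1 - p n a \<omega>) \<partial>M) else 0)" for l
    using cov_step[of n a n l] integral_\<xi>_mult_Z[of n a l] integral_\<xi>_mult_X[of n a l]
    by (simp add: cov_def)
  show "cov n a (Suc n + Suc k) = (1 - r (Suc n + k)) *\<^sub>R cov n a (Suc n + k) +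
      r (Suc n + k) *\<^sub>R (transpose W *v cov n a (Suc n + k))" for k
    using cov_Suc[of n "Suc n + k" a] by simp
qed (intro less_imp_le r_pos r_less_1)+

section \<open>Propagation of extreme values through the network and back in time\<close>

text \<open>If a vertex sits at an extreme value at two consecutive times, its draw was forced, so
  the conditional probability of the draw is that value.\<close>

lemma p_eq_Z:
  assumes "AE \<omega> in M. Z n \<omega> $ j \<in> {0, 1}" and "AE \<omega> in M. Z (Suc n) \<omega> $ j \<in> {0, 1}"
  shows "AE \<omega> in M. p n j \<omega> = Z n \<omega> $ j"
proof -
  interpret sigma_finite_subalgebra M "F n" by (rule sigma_finite_F)
  let ?E = "{\<omega> \<in> space M. X (Suc n) \<omega> $ j = 1}"
  have "AE \<omega> in M. indicator ?E \<omega> = Z n \<omega> $ j"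
    using assms AE_space
  proof eventually_elim
    case (elim \<omega>)
    \<comment> \<open>As \<open>0 < r n < 1\<close>, a draw different from \<open>Z n\<close> would
      put \<open>Z (Suc n)\<close> strictly between 0 and 1.\<close>
    have "X (Suc n) \<omega> $ j = Z n \<omega> $ j"
      using elim(1,2) X_range[OF elim(3), of n j] Z_Suc_nth[OF elim(3), of n j]
        r_pos[of n] r_less_1[of n] by auto
    then show ?case by (rule X_eq_indicator[OF elim(3), symmetric, THEN trans])
  qed
  then have "AE \<omega> in M. real_cond_exp M (F n) (indicator ?E) \<omega> =
      real_cond_exp M (F n) (\<lambda>\<omega>. Z n \<omega> $ j) \<omega>"
    by (rule real_cond_exp_cong) auto
  moreover have "AE \<omega> in M. real_cond_exp M (F n) (\<lambda>\<omega>. Z n \<omega> $ j) \<omega> = Z n \<omega> $ j"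
    by (rule real_cond_exp_F_meas[OF bounded_integrable[OF _ abs_le_one(2)] Z_F]) simp_all
  moreover note X_prob_p[of n j]
  ultimately show ?thesis
    unfolding prob_given_def by eventually_elim simp
qed

text \<open>\<open>p n a\<close> is a weighted average of numbers in \<open>[0,1]\<close>; at an
  extreme value, every term of positive weight must be extreme too. The value 1 is treated by
  passing to \<open>1 - Z n\<close>.\<close>

lemma neighbour_eq:
  assumes \<omega>: "\<omega> \<in> space M" and p01: "p n a \<omega> \<in> {0, 1}" and pos: "0 < W $ i $ a"
  shows "Z n \<omega> $ i = p n a \<omega>"
proof -
  have W_sum: "(\<Sum>j\<in>UNIV. W $ j $ a) = 1"
    using arg_cong[OF W_one, of "\<lambda>x. x $ a"]
    by (simp add: matrix_vector_mult_def transpose_def)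
  consider "p n a \<omega> = 0" | "p n a \<omega> = 1" using p01 by auto
  then show ?thesis
  proof cases
    case 1
    then have "(\<Sum>j\<in>UNIV. W $ j $ a * Z n \<omega> $ j) = 0" by (simp add: p_eq)
    then have "W $ i $ a * Z n \<omega> $ i = 0"
      by (subst (asm) sum_nonneg_eq_0_iff)
        (use W_nonneg Z_range[OF \<omega>] in \<open>auto intro!: mult_nonneg_nonneg\<close>)
    then show ?thesis using 1 pos by simp
  next
    case 2
    then have "(\<Sum>j\<in>UNIV. W $ j $ a * (1 - Z n \<omega> $ j)) = 0"
      by (simp add: p_eq right_diff_distrib sum_subtractf W_sum)
    then have "W $ i $ a * (1 - Z n \<omega> $ i) = 0"
      by (subst (asm) sum_nonneg_eq_0_iff)
        (use W_nonneg Z_range[OF \<omega>] in \<open>auto intro!: mult_nonneg_nonneg\<close>)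
    then show ?thesis using 2 pos by simp
  qed
qed

text \<open>Induction along a path from \<open>i\<close> to \<open>a\<close>. If \<open>h\<close>
  follows \<open>i\<close>, \<open>neighbour_eq\<close> transfers the extreme value of
  \<open>p\<close> at \<open>h\<close> to \<open>Z\<close> at \<open>i\<close>, and
  \<open>p_eq_Z\<close> turns this into a statement on \<open>p\<close> at \<open>i\<close>, ready
  for the next edge. The empty path says nothing about \<open>Z\<close>, hence the guard
  \<open>1 \<le> k\<close>.\<close>

lemma mat_power_degenerate:
  assumes deg: "\<And>n. n0 \<le> n \<Longrightarrow> AE \<omega> in M. p n a \<omega> \<in> {0, 1}"
    and "0 < mat_power W k $ i $ a" and "n0 \<le> n"
  shows "AE \<omega> in M. p n i \<omega> = p n a \<omega> \<and> (1 \<le> k \<longrightarrow> Z n \<omega> $ i = p n a \<omega>)"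
  using assms(2,3)
proof (induction k arbitrary: i n)
  case 0
  then have "i = a" by (simp add: mat_def split: if_splits)
  then show ?case by simp
next
  case (Suc k)
  have "0 < (\<Sum>h\<in>UNIV. W $ i $ h * mat_power W k $ h $ a)"
    using Suc.prems by (simp add: matrix_matrix_mult_def)
  then obtain h where "0 < W $ i $ h * mat_power W k $ h $ a"
    by (metis (no_types, lifting) not_less sum_nonpos)
  then have h: "0 < W $ i $ h" "0 < mat_power W k $ h $ a"
    using W_nonneg[of i h] mat_power_nonneg[OF W_nonneg, of k h a]
    by (auto simp: zero_less_mult_iff)
  \<comment> \<open>All late times are covered at once, since \<open>p_eq_Z\<close> needs two
    consecutive ones.\<close>
  have Z: "AE \<omega> in M. Z m \<omega> $ i = p m a \<omega> \<and> Z m \<omega> $ i \<in> {0, 1}" if "n0 \<le> m" for m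
    using Suc.IH[OF h(2) that] deg[OF that] AE_space
  proof eventually_elim
    case (elim \<omega>)
    then show ?case using neighbour_eq[OF elim(3), of m h i] h(1) by simp
  qed
  have "AE \<omega> in M. p n i \<omega> = Z n \<omega> $ i"
    by (rule p_eq_Z) (use Z[of n] Z[of "Suc n"] Suc.prems in \<open>auto elim: eventually_mono\<close>)
  with Z[OF Suc.prems(2)] show ?case by eventually_elim simp
qed

text \<open>A convex combination of points of \<open>[0,1]\<close> with both weights positive is an
  endpoint only if both points are that endpoint.\<close>

lemma extreme_backwards:
  assumes \<omega>: "\<omega> \<in> space M" and c: "c \<in> {0, 1}"
  shows "Z n \<omega> $ l = c \<Longrightarrow> Z 0 \<omega> $ l = c"
proof (induction n)
  case (Suc n)
  have r: "0 < 1 - r n" "0 < r n" using r_pos[of n] r_less_1[of n] by auto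
  have Z: "0 \<le> Z n \<omega> $ l" "Z n \<omega> $ l \<le> 1" using Z_range[OF \<omega>, of n l] by auto
  have X: "X (Suc n) \<omega> $ l = 0 \<or> X (Suc n) \<omega> $ l = 1" using X_range[OF \<omega>, of n l] by auto
  have eq: "(1 - r n) * Z n \<omega> $ l + r n * X (Suc n) \<omega> $ l = c"
    using Suc.prems by (simp add: Z_Suc_nth[OF \<omega>])
  have bounds: "0 \<le> (1 - r n) * Z n \<omega> $ l" "(1 - r n) * Z n \<omega> $ l \<le> 1 - r n"
    using r Z by (auto intro: mult_left_le)
  have "(1 - r n) * Z n \<omega> $ l = (1 - r n) * c"
  proof (cases "c = 0")
    case True
    from X show ?thesis
    proof
      assume "X (Suc n) \<omega> $ l = 1"
      then have False using eq bounds(1) r(2) True by simp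
      then show ?thesis ..
    qed (use eq True in simp)
  next
    case False
    then have "c = 1" using c by simp
    from X show ?thesis
    proof
      assume "X (Suc n) \<omega> $ l = 0"
      then have False using eq bounds(2) r(2) \<open>c = 1\<close> by simp
      then show ?thesis ..
    next
      assume "X (Suc n) \<omega> $ l = 1"
      then have "(1 - r n) * Z n \<omega> $ l + r n = 1" using eq \<open>c = 1\<close> by simp
      then show ?thesis unfolding \<open>c = 1\<close> by algebra
    qed
  qed
  then show ?case using r by (intro Suc.IH) simp
qed simp

lemma consensus_imp_extreme_start:
  assumes "irreducible_mat W" and deg: "\<And>n. n0 \<le> n \<Longrightarrow> AE \<omega> in M. p n a \<omega> \<in> {0, 1}"
  shows "AE \<omega> in M. Z 0 \<omega> = 0 \<or> Z 0 \<omega> = 1"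
proof -
  have "AE \<omega> in M. Z n0 \<omega> $ i = p n0 a \<omega>" for i
  proof -
    \<comment> \<open>For \<open>i = a\<close> as well a path of positive length is taken, so that
      the conclusion about \<open>Z\<close> is available.\<close>
    obtain k where k: "1 \<le> k" "0 < mat_power W k $ i $ a"
      using assms(1) unfolding irreducible_mat_def by blast
    have "AE \<omega> in M. p n0 i \<omega> = p n0 a \<omega> \<and> (1 \<le> k \<longrightarrow> Z n0 \<omega> $ i = p n0 a \<omega>)"
      by (rule mat_power_degenerate[OF deg k(2) order_refl])
    then show ?thesis by eventually_elim (use k(1) in simp)
  qed
  then have "AE \<omega> in M. \<forall>i. Z n0 \<omega> $ i = p n0 a \<omega>"
    by (rule eventually_all_finite)
  with deg[OF order_refl] AE_space show ?thesis
  proof eventually_elim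
    case (elim \<omega>)
    have "Z 0 \<omega> $ i = p n0 a \<omega>" for i
      by (rule extreme_backwards[OF elim(2,1), of n0]) (use elim(3) in simp)
    then show ?case using elim(1) by (auto simp: vec_eq_iff)
  qed
qed

end

section \<open>Summable steps: existence and distinctness of the limits\<close>

locale summable_reinforced_network = reinforced_network +
  assumes r_summable: "summable r"
begin

lemma Z_nth_convergent:
  assumes "\<omega> \<in> space M"
  shows "convergent (\<lambda>n. Z n \<omega> $ l)"
proof (rule convergent_if_summable_increments[OF r_summable])
  fix n
  have "Z (Suc n) \<omega> $ l - Z n \<omega> $ l = r n * (X (Suc n) \<omega> $ l - Z n \<omega> $ l)"
    using assms by (simp add: Z_Suc_nth algebra_simps)
  moreover have "\<bar>X (Suc n) \<omega> $ l - Z n \<omega> $ l\<bar> \<le> 1"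
    using X_range[OF assms, of n l] Z_range[OF assms, of n l] by auto
  ultimately show "norm (Z (Suc n) \<omega> $ l - Z n \<omega> $ l) \<le> r n"
    using r_pos[of n] by (simp add: abs_mult mult_left_le)
qed

lemma Z_convergent: "\<omega> \<in> space M \<Longrightarrow> convergent (\<lambda>n. Z n \<omega>)"
  by (rule vec_convergentI) (rule Z_nth_convergent)

text \<open>Equal limits force the covariances at \<open>a\<close> and \<open>b\<close> to become
  equal asymptotically, by dominated convergence, while \<open>cov_separates\<close> keeps their
  difference above a fixed multiple of the expected conditional variance. Hence that variance is
  zero.\<close>

lemma p_degenerate:
  assumes eq: "AE \<omega> in M. lim (\<lambda>n. Z n \<omega> $ a) = lim (\<lambda>n. Z n \<omega> $ b)" and "b \<noteq> a"
    and tail: "(\<Sum>k. r (k + Suc n)) \<le> 1/4"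
  shows "AE \<omega> in M. p n a \<omega> \<in> {0, 1}"
proof -
  let ?s = "\<integral>\<omega>. p n a \<omega> * (1 - p n a \<omega>) \<partial>M"
  let ?D = "\<lambda>m \<omega>. \<xi> n a \<omega> * Z m \<omega> $ a - \<xi> n a \<omega> * Z m \<omega> $ b"
  have nonneg: "0 \<le> p n a \<omega> * (1 - p n a \<omega>)" if "\<omega> \<in> space M" for \<omega>
    using p_range[OF that, of n a] by simp
  have s: "0 \<le> ?s"
    by (rule integral_nonneg_AE) (use nonneg in auto)
  have "(\<lambda>m. \<integral>\<omega>. ?D m \<omega> \<partial>M) \<longlonglongrightarrow> (\<integral>\<omega>. 0 \<partial>M)"
  proof (rule integral_dominated_convergence[where w = "\<lambda>_. 2"])
    show "AE \<omega> in M. (\<lambda>m. ?D m \<omega>) \<longlonglongrightarrow> 0"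
      using eq AE_space
    proof eventually_elim
      case (elim \<omega>)
      have "(\<lambda>m. ?D m \<omega>) \<longlonglongrightarrow> \<xi> n a \<omega> * lim (\<lambda>n. Z n \<omega> $ a) - \<xi> n a \<omega> * lim (\<lambda>n. Z n \<omega> $ b)"
        using Z_nth_convergent[OF elim(2)]
        by (intro tendsto_intros) (simp_all add: convergent_LIMSEQ_iff)
      then show ?case using elim(1) by simp
    qed
    show "AE \<omega> in M. norm (?D m \<omega>) \<le> 2" for m
    proof (rule AE_I2)
      fix \<omega> assume \<omega>: "\<omega> \<in> space M"
      note le = abs_mult_le_one[OF abs_le_one(4)[OF \<omega>, of n a] abs_le_one(2)[OF \<omega>, of m]]
      show "norm (?D m \<omega>) \<le> 2" using le[of a] le[of b] by simp
    qed
  qed simp_all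
  moreover have "(\<integral>\<omega>. ?D m \<omega> \<partial>M) = cov n a m $ a - cov n a m $ b" for m
    by (simp add: cov_def integrable_\<xi>_mult)
  ultimately have "(\<lambda>m. cov n a m $ a - cov n a m $ b) \<longlonglongrightarrow> 0" by simp
  from LIMSEQ_ignore_initial_segment[OF this, of "Suc n"]
  have lim: "(\<lambda>m. cov n a (Suc n + m) $ a - cov n a (Suc n + m) $ b) \<longlonglongrightarrow> 0"
    by (simp add: add.commute)
  have "r n * ?s * (1/2) \<le> cov n a (Suc n + m) $ a - cov n a (Suc n + m) $ b" for m
  proof -
    have "(\<Sum>k<m. r (k + Suc n)) \<le> (\<Sum>k. r (k + Suc n))"
      by (rule sum_le_suminf) (simp_all only: summable_ignore_initial_segment[OF r_summable]
          less_imp_le[OF r_pos] finite_lessThan)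
    \<comment> \<open>The tail bound \<open>1/4\<close> is chosen so that this factor stays away
      from zero uniformly in \<open>m\<close>.\<close>
    then have "1/2 \<le> 1 - 2 * (\<Sum>k<m. r (Suc n + k))"
      using tail by (simp add: add.commute)
    then have "r n * ?s * (1/2) \<le> r n * ?s * (1 - 2 * (\<Sum>k<m. r (Suc n + k)))"
      using s r_pos[of n] by (intro mult_left_mono) auto
    also note cov_separates[OF \<open>b \<noteq> a\<close>]
    finally show ?thesis .
  qed
  then have "r n * ?s * (1/2) \<le> 0"
    by (intro LIMSEQ_le_const[OF lim]) auto
  then have "?s = 0"
    using s r_pos[of n] by (simp add: mult_le_0_iff)
  moreover have "integrable M (\<lambda>\<omega>. p n a \<omega> * (1 - p n a \<omega>))"
    using p_range[of _ n a] by (intro integrable_mult) auto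
  ultimately have "AE \<omega> in M. p n a \<omega> * (1 - p n a \<omega>) = 0"
    using integral_nonneg_eq_0_iff_AE[of M "\<lambda>\<omega>. p n a \<omega> * (1 - p n a \<omega>)"] nonneg
    by auto
  then show ?thesis by eventually_elim auto
qed

lemma prob_limits_differ:
  assumes "irreducible_mat W" and start: "\<P>(\<omega> in M. Z 0 \<omega> = 0) + \<P>(\<omega> in M. Z 0 \<omega> = 1) < 1"
    and "a \<noteq> b"
  shows "0 < \<P>(\<omega> in M. lim (\<lambda>n. Z n \<omega> $ a) \<noteq> lim (\<lambda>n. Z n \<omega> $ b))"
proof (rule ccontr)
  let ?D = "{\<omega> \<in> space M. lim (\<lambda>n. Z n \<omega> $ a) \<noteq> lim (\<lambda>n. Z n \<omega> $ b)}"
  assume "\<not> 0 < \<P>(\<omega> in M. lim (\<lambda>n. Z n \<omega> $ a) \<noteq> lim (\<lambda>n. Z n \<omega> $ b))"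
  then have "prob ?D = 0" by (simp add: zero_less_measure_iff)
  moreover have "?D \<in> events" by measurable
  ultimately have eq: "AE \<omega> in M. lim (\<lambda>n. Z n \<omega> $ a) = lim (\<lambda>n. Z n \<omega> $ b)"
    by (subst (asm) prob_Collect_eq_0) auto
  have "(\<lambda>n. \<Sum>k. r (k + n)) \<longlonglongrightarrow> 0"
    by (rule suminf_exist_split2[OF r_summable])
  then have "eventually (\<lambda>n. (\<Sum>k. r (k + n)) < 1/4) sequentially"
    by (rule order_tendstoD) simp
  then obtain n0 where n0: "(\<Sum>k. r (k + n)) < 1/4" if "n0 \<le> n" for n
    by (auto simp: eventually_sequentially)
  \<comment> \<open>The steps that follow the draw at time \<open>Suc n\<close> begin with
    \<open>r (Suc n)\<close>, so the tail bound is used at \<open>Suc n\<close>.\<close>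
  have "AE \<omega> in M. p n a \<omega> \<in> {0, 1}" if "n0 \<le> n" for n
    by (rule p_degenerate[OF eq]) (use n0[of "Suc n"] that \<open>a \<noteq> b\<close> in auto)
  then have ae: "AE \<omega> in M. Z 0 \<omega> = 0 \<or> Z 0 \<omega> = 1"
    by (rule consensus_imp_extreme_start[OF assms(1)])
  have sets: "{\<omega> \<in> space M. Z 0 \<omega> = c} \<in> events" for c
    using measurable_sets[OF Z_0_measurable, of "{c}"]
    by (simp add: vimage_def Int_def conj_commute)
  \<comment> \<open>An almost surely extreme start contradicts \<open>start\<close> by
    subadditivity.\<close>
  have "1 = prob ({\<omega> \<in> space M. Z 0 \<omega> = 0} \<union> {\<omega> \<in> space M. Z 0 \<omega> = 1})"
    by (rule prob_eq_1[THEN iffD2, symmetric]) (use sets ae in \<open>auto elim: eventually_mono\<close>)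
  also have "\<dots> \<le> \<P>(\<omega> in M. Z 0 \<omega> = 0) + \<P>(\<omega> in M. Z 0 \<omega> = 1)"
    by (rule measure_Un_le) (rule sets)+
  finally show False using start by simp
qed

end

theorem proposition3p1:
  fixes M :: "'a measure"
    and W :: "real^'n^'n" and v :: "real^'n"
    and r :: "nat \<Rightarrow> real"
    and Z X :: "nat \<Rightarrow> 'a \<Rightarrow> real^'n"
  assumes "prob_space M"
    and "CARD('n) \<ge> 2"
    and "\<And>i j. 0 \<le> W $ i $ j"
    and "irreducible_mat W"
    and "transpose W *v 1 = 1"
    and "\<And>n. 0 < r n" and "\<And>n. r n < 1"
    and "Z 0 \<in> borel_measurable M"
    and "\<And>\<omega> l. \<omega> \<in> space M \<Longrightarrow> Z 0 \<omega> $ l \<in> {0..1}"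
    and "\<P>(\<omega> in M. Z 0 \<omega> = 0) + \<P>(\<omega> in M. Z 0 \<omega> = 1) < 1"
    and "\<And>n. X (Suc n) \<in> borel_measurable M"
    and "\<And>n \<omega> l. \<omega> \<in> space M \<Longrightarrow> X (Suc n) \<omega> $ l \<in> {0, 1}"
    and "\<And>n. cond_indep_vars M (history M Z X n) (\<lambda>_. borel) (\<lambda>l \<omega>. X (Suc n) \<omega> $ l) UNIV"
    and "\<And>n l. AE \<omega> in M.
           prob_given M (history M Z X n) {\<omega> \<in> space M. X (Suc n) \<omega> $ l = 1} \<omega> =
           (transpose W *v Z n \<omega>) $ l"
    and "\<And>n \<omega>. \<omega> \<in> space M \<Longrightarrow>
           Z (Suc n) \<omega> = (1 - r n) *\<^sub>R Z n \<omega> + r n *\<^sub>R X (Suc n) \<omega>"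
    and "\<And>l. 0 < v $ l" and "v v* transpose W = v" and "v \<bullet> 1 = 1"
    and "summable r"
  shows "(AE \<omega> in M. convergent (\<lambda>n. Z n \<omega>)) \<and>
    (AE \<omega> in M. convergent (\<lambda>n. part1 v (Z n \<omega>))) \<and>
    (AE \<omega> in M. convergent (\<lambda>n. part2 (transpose W) v (Z n \<omega>))) \<and>
    (AE \<omega> in M. convergent (\<lambda>n. part3 (transpose W) v (Z n \<omega>))) \<and>
    (\<forall>l1 l2. l1 \<noteq> l2 \<longrightarrow>
       0 < \<P>(\<omega> in M. lim (\<lambda>n. Z n \<omega> $ l1) \<noteq> lim (\<lambda>n. Z n \<omega> $ l2)))"
proof -
  interpret summable_reinforced_network M W r Z X
    by (rule summable_reinforced_network.intro,
        rule reinforced_network.intro[OF assms(1)],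
        unfold_locales) (use assms in simp_all)
  show ?thesis
    \<comment> \<open>The paths converge at every point of the space, and the three parts are
      continuous functions of \<open>Z n\<close>.\<close>
    by (intro conjI allI impI AE_I2 prob_limits_differ[OF assms(4,10)]
        convergent_part1 convergent_part2 convergent_part3 Z_convergent)
qed

end
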